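(* Let $c_0,\gamma_0,\lambda_0,\alpha>0$ and let the per-seat fleet and operation costs depend on the vehicle size $c$ by $\gamma=\frac{\gamma_0(c_0+\alpha c)}{c}$ and $\lambda=\frac{\lambda_0(c_0+\alpha c)}{c}$. Consider the off-peak problem of choosing the vehicle size $c=c(t)>0$, $t\in\mathbf{E}_{op}$, to $$\min_{c}\ \mathcal{J}_{op}=\int_{t\in\mathbf{E}_{op}}\left(\frac{\lambda_0(c_0+\alpha c)}{c}g_{op}^*(t)+\frac{cf(t)}{2g_{op}^*(t)}\right)dt=\int_{t\in\mathbf{E}_{op}}\sqrt{2\lambda_0(c_0+\alpha c)f(t)}\,dt$$ with $g_{op}^*(t)=\sqrt{\dfrac{cf(t)}{2\lambda_0(c_0+\alpha c)/c}}$, subject to $$c\ge 2\,\frac{\lambda_0(c_0+\alpha c)}{c}f(t),\quad t\in\mathbf{E}_{op},\qquad\text{and}\qquad \int_{t-T}^{t}g_{op}^*(s)\,ds\le M,\quad t\in\mathbf{E}_{op}.$$ Then the optimal solution is $$\tilde c_{op}(t)=\lambda_0\alpha f(t)+\sqrt{2\lambda_0c_0f(t)+\big(\lambda_0\alpha f(t)\big)^2},\qquad t\in\mathbf{E}_{op}.$$ Moreover, with $c=\tilde c_{op}(t)$ one has $g_{op}^*(t)=f(t)$ and the fleet size constraint is always satisfied.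
   Context: A single shuttle/feeder bus line has effective boarding demand arrival rate $f(t)$ and constant cycle time $T$. Buses are dispatched at rate $g(t)$ (seats per hour) from a fleet of $M$ seats. $\gamma$ is the fixed cost per seat in the fleet and $\lambda$ is the operation cost per dispatched seat. The off-peak period $\mathbf{E}_{op}$ is the set of times outside the peak period $[t_q-T,t_d]$, where $t_q$ and $t_d$ are the times when a queue of patrons first forms and dissipates. For fixed vehicle size $c$, the off-peak cost rate is $\lambda g(t)+\frac{cf(t)}{2g(t)}$. The constraint $c\ge 2\lambda f(t)$ is equivalent to $g_{op}^*(t)\ge f(t)$, which guarantees that no queue forms. The vehicle size may vary continuously with $t$. The fleet size is determined by the peak period, $M=\int_{t_q-T}^{t_q}g_{pk}^*(s)\,ds$ with $g_{pk}^*(s)=f(s)$ on $[t_q-T,t_q)$, and $f$ in the off-peak period is no larger than in the peak period. *)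

theory Defs
  imports "HOL-Analysis.Analysis"
begin

text \<open>Cost per seat when the vehicle size is \<open>c\<close>: \<open>a = \<gamma>\<^sub>0\<close> gives the fixed cost per seat
  of the fleet, \<open>a = l\<^sub>0\<close> the operation cost per dispatched seat (\<open>l\<^sub>0\<close> and not \<open>\<lambda>\<^sub>0\<close>,
  since \<open>\<lambda>\<close> is not a letter).  Only the operation cost enters the off-peak problem.\<close>

definition seat_cost :: "real \<Rightarrow> real \<Rightarrow> real \<Rightarrow> real \<Rightarrow> real" where
  "seat_cost a c\<^sub>0 \<alpha> c = a * (c\<^sub>0 + \<alpha> * c) / c"

definition peak_period :: "real \<Rightarrow> real \<Rightarrow> real \<Rightarrow> real set" where
  "peak_period T t\<^sub>q t\<^sub>d = {t\<^sub>q - T..t\<^sub>d}"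

text \<open>\<open>E\<close> is the set of all times under study.\<close>

definition off_peak :: "real set \<Rightarrow> real \<Rightarrow> real \<Rightarrow> real \<Rightarrow> real set" where
  "off_peak E T t\<^sub>q t\<^sub>d = E - peak_period T t\<^sub>q t\<^sub>d"

definition g_op ::
  "real \<Rightarrow> real \<Rightarrow> real \<Rightarrow> (real \<Rightarrow> real) \<Rightarrow> (real \<Rightarrow> real) \<Rightarrow> real \<Rightarrow> real" where
  "g_op l\<^sub>0 c\<^sub>0 \<alpha> f c t = sqrt (c t * f t / (2 * seat_cost l\<^sub>0 c\<^sub>0 \<alpha> (c t)))"

text \<open>The integrands below are nonnegative, so integrals take values in \<open>[0, \<infinity>]\<close>; a
  non-integrable vehicle size thus has infinite cost, rather than the cost \<open>0\<close> that the
  Bochner integral would assign to it.\<close>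

definition J_op ::
  "real set \<Rightarrow> real \<Rightarrow> real \<Rightarrow> real \<Rightarrow> (real \<Rightarrow> real) \<Rightarrow> (real \<Rightarrow> real) \<Rightarrow> ennreal" where
  "J_op Eop l\<^sub>0 c\<^sub>0 \<alpha> f c =
     (\<integral>\<^sup>+t\<in>Eop. ennreal (seat_cost l\<^sub>0 c\<^sub>0 \<alpha> (c t) * g_op l\<^sub>0 c\<^sub>0 \<alpha> f c t
                        + c t * f t / (2 * g_op l\<^sub>0 c\<^sub>0 \<alpha> f c t)) \<partial>lborel)"

text \<open>The time window \<open>[t - T, t]\<close> of an off-peak time \<open>t\<close> may overlap the peak period, where
  the off-peak dispatch rate is not defined.  The rate used there is a parameter \<open>h\<close>.\<close>

definition fleet_constraint ::
  "real set \<Rightarrow> real set \<Rightarrow> real \<Rightarrow> real \<Rightarrow> (real \<Rightarrow> real) \<Rightarrow> (real \<Rightarrow> real) \<Rightarrow> bool" where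
  "fleet_constraint Eop Epk T M h g \<longleftrightarrow>
     (\<forall>t\<in>Eop. (\<integral>\<^sup>+s\<in>{t - T..t}.
        ennreal (if s \<in> Eop then g s else if s \<in> Epk then h s else 0) \<partial>lborel) \<le> ennreal M)"

text \<open>The two admissible choices of \<open>h\<close>.  With \<open>h = 0\<close> only seats dispatched off-peak are
  counted, i.e. the integral is literally one of the off-peak dispatch rate.  With
  \<open>h = g_pk\<close> the seats dispatched in the peak period that have not yet returned are counted as
  well; here \<open>g_pk\<close> is such that, while there is a queue, a seat returning after one cycle is
  dispatched again at once.\<close>

definition peak_carryover ::
  "real \<Rightarrow> real \<Rightarrow> real \<Rightarrow> (real \<Rightarrow> real) \<Rightarrow> (real \<Rightarrow> real) \<Rightarrow> bool" where
  "peak_carryover T t\<^sub>q t\<^sub>d g_pk h \<longleftrightarrow>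
     h = (\<lambda>_. 0) \<or> (h = g_pk \<and> (\<forall>t\<in>{t\<^sub>q..t\<^sub>d}. g_pk t = g_pk (t - T)))"

definition feasible_op ::
  "real set \<Rightarrow> real set \<Rightarrow> real \<Rightarrow> real \<Rightarrow> (real \<Rightarrow> real) \<Rightarrow> real \<Rightarrow> real \<Rightarrow> real
     \<Rightarrow> (real \<Rightarrow> real) \<Rightarrow> (real \<Rightarrow> real) \<Rightarrow> bool" where
  "feasible_op Eop Epk T M h l\<^sub>0 c\<^sub>0 \<alpha> f c \<longleftrightarrow>
     set_borel_measurable lborel Eop c \<and>
     (\<forall>t\<in>Eop. c t > 0) \<and>
     (\<forall>t\<in>Eop. c t \<ge> 2 * seat_cost l\<^sub>0 c\<^sub>0 \<alpha> (c t) * f t) \<and>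
     fleet_constraint Eop Epk T M h (g_op l\<^sub>0 c\<^sub>0 \<alpha> f c)"

definition optimal_op ::
  "real set \<Rightarrow> real set \<Rightarrow> real \<Rightarrow> real \<Rightarrow> (real \<Rightarrow> real) \<Rightarrow> real \<Rightarrow> real \<Rightarrow> real
     \<Rightarrow> (real \<Rightarrow> real) \<Rightarrow> (real \<Rightarrow> real) \<Rightarrow> bool" where
  "optimal_op Eop Epk T M h l\<^sub>0 c\<^sub>0 \<alpha> f c \<longleftrightarrow>
     feasible_op Eop Epk T M h l\<^sub>0 c\<^sub>0 \<alpha> f c \<and>
     (\<forall>c'. feasible_op Eop Epk T M h l\<^sub>0 c\<^sub>0 \<alpha> f c' \<longrightarrow>
        J_op Eop l\<^sub>0 c\<^sub>0 \<alpha> f c \<le> J_op Eop l\<^sub>0 c\<^sub>0 \<alpha> f c')"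

definition c_opt :: "real \<Rightarrow> real \<Rightarrow> real \<Rightarrow> (real \<Rightarrow> real) \<Rightarrow> real \<Rightarrow> real" where
  "c_opt l\<^sub>0 c\<^sub>0 \<alpha> f t = l\<^sub>0 * \<alpha> * f t + sqrt (2 * l\<^sub>0 * c\<^sub>0 * f t + (l\<^sub>0 * \<alpha> * f t)\<^sup>2)"

end

theory Submission
  imports Defs
begin

text \<open>For \<open>c > 0\<close> the constraint \<open>c \<ge> 2 \<lambda> f\<close> reads
  \<open>c\<^sup>2 - 2 l\<^sub>0 \<alpha> f c - 2 l\<^sub>0 c\<^sub>0 f \<ge> 0\<close>, i.e. \<open>c\<close> is at least the positive root \<open>c_opt\<close>; since the
  cost rate is strictly increasing in \<open>c\<close>, the root is optimal, and uniquely so almost everywhere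
  whenever the optimal cost is finite.  At the root \<open>g_op = f\<close>.  For the fleet constraint, reduce
  times modulo \<open>T\<close> to \<open>[t\<^sub>q - T, t\<^sub>q)\<close>: off-peak demand is below peak demand, and a peak dispatch
  rate is \<open>T\<close>-periodic, so the total rate in any window of length \<open>T\<close> is dominated by the
  periodic extension of \<open>f\<close>, whose integral is \<open>M\<close>.\<close>

text \<open>Subtracting \<open>l\<^sub>0 * \<alpha> * f t\<close> from \<open>c_opt\<close> leaves a
  square root; its radicand is nonnegative, so squaring removes the root.\<close>

lemma c_opt_quadratic:
  assumes "0 \<le> 2 * l\<^sub>0 * c\<^sub>0 * f t + (l\<^sub>0 * \<alpha> * f t)\<^sup>2"
  shows "(c_opt l\<^sub>0 c\<^sub>0 \<alpha> f t)\<^sup>2 = 2 * (l\<^sub>0 * (c\<^sub>0 + \<alpha> * c_opt l\<^sub>0 c\<^sub>0 \<alpha> f t)) * f t"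
proof -
  have "(sqrt (2 * l\<^sub>0 * c\<^sub>0 * f t + (l\<^sub>0 * \<alpha> * f t)\<^sup>2))\<^sup>2 = 2 * l\<^sub>0 * c\<^sub>0 * f t + (l\<^sub>0 * \<alpha> * f t)\<^sup>2"
    using assms by simp
  then show ?thesis
    unfolding c_opt_def by (simp add: power2_eq_square algebra_simps)
qed

context
  fixes c\<^sub>0 l\<^sub>0 \<alpha> :: real
  assumes pos: "c\<^sub>0 > 0" "l\<^sub>0 > 0" "\<alpha> > 0"
begin

lemma c_opt_pos:
  assumes "f t > 0"
  shows "c_opt l\<^sub>0 c\<^sub>0 \<alpha> f t > 0"
  unfolding c_opt_def using assms pos by (intro add_pos_nonneg) auto

lemma seat_cost_pos:
  assumes "c > 0"
  shows "seat_cost l\<^sub>0 c\<^sub>0 \<alpha> c > 0"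
  unfolding seat_cost_def using assms pos by (simp add: add_pos_pos)

text \<open>Dividing the quadratic equation by its positive root shows that the vehicle size
  constraint is tight there.\<close>

lemma c_opt_eq_seat_cost:
  assumes "f t > 0"
  shows "c_opt l\<^sub>0 c\<^sub>0 \<alpha> f t = 2 * seat_cost l\<^sub>0 c\<^sub>0 \<alpha> (c_opt l\<^sub>0 c\<^sub>0 \<alpha> f t) * f t"
proof -
  let ?c = "c_opt l\<^sub>0 c\<^sub>0 \<alpha> f t"
  have c: "?c > 0"
    using assms by (rule c_opt_pos)
  have "?c * ?c = 2 * (l\<^sub>0 * (c\<^sub>0 + \<alpha> * ?c)) * f t"
    using c_opt_quadratic[of l\<^sub>0 c\<^sub>0 f t \<alpha>] assms pos by (simp add: power2_eq_square)
  with c show ?thesis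
    unfolding seat_cost_def by (simp add: field_simps)
qed

text \<open>Completing the square turns the constraint into a lower bound on the distance of
  \<open>c\<close> from \<open>l\<^sub>0 * \<alpha> * f t\<close>. Hence \<open>c\<close> lies
  beyond the larger root or below the smaller one, and positivity excludes the latter.\<close>

lemma c_opt_le:
  assumes f: "f t > 0" and c: "c > 0" and ge: "c \<ge> 2 * seat_cost l\<^sub>0 c\<^sub>0 \<alpha> c * f t"
  shows "c_opt l\<^sub>0 c\<^sub>0 \<alpha> f t \<le> c"
proof -
  have "2 * (l\<^sub>0 * (c\<^sub>0 + \<alpha> * c)) * f t \<le> c * c"
    using ge c unfolding seat_cost_def by (simp add: field_simps)
  then have "2 * l\<^sub>0 * c\<^sub>0 * f t + (l\<^sub>0 * \<alpha> * f t)\<^sup>2 \<le> (c - l\<^sub>0 * \<alpha> * f t)\<^sup>2"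
    by (simp add: power2_eq_square algebra_simps)
  then have le: "sqrt (2 * l\<^sub>0 * c\<^sub>0 * f t + (l\<^sub>0 * \<alpha> * f t)\<^sup>2) \<le> \<bar>c - l\<^sub>0 * \<alpha> * f t\<bar>"
    using real_sqrt_le_mono by fastforce
  \<comment> \<open>So the smaller root is at most 0, and the branch below it contradicts
    \<open>c > 0\<close>.\<close>
  have "l\<^sub>0 * \<alpha> * f t \<le> sqrt (2 * l\<^sub>0 * c\<^sub>0 * f t + (l\<^sub>0 * \<alpha> * f t)\<^sup>2)"
    using f pos by (intro real_le_rsqrt) simp
  with le c show ?thesis
    unfolding c_opt_def by linarith
qed

text \<open>With \<open>k\<close> the seat cost, tightness gives \<open>c = 2 * k * f\<close>, so
  the radicand \<open>c * f / (2 * k)\<close> in \<open>g_op\<close> is the square of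
  \<open>f\<close>.\<close>

lemma g_op_c_opt:
  assumes "f t > 0"
  shows "g_op l\<^sub>0 c\<^sub>0 \<alpha> f (c_opt l\<^sub>0 c\<^sub>0 \<alpha> f) t = f t"
proof -
  let ?c = "c_opt l\<^sub>0 c\<^sub>0 \<alpha> f t"
  have "2 * seat_cost l\<^sub>0 c\<^sub>0 \<alpha> ?c \<noteq> 0"
    using seat_cost_pos[OF c_opt_pos[of f t, OF assms]] by simp
  moreover have "?c * f t = (f t)\<^sup>2 * (2 * seat_cost l\<^sub>0 c\<^sub>0 \<alpha> ?c)"
    using c_opt_eq_seat_cost[of f t, OF assms] by (simp add: power2_eq_square ac_simps)
  ultimately have "?c * f t / (2 * seat_cost l\<^sub>0 c\<^sub>0 \<alpha> ?c) = (f t)\<^sup>2"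
    by (rule nonzero_divide_eq_eq[THEN iffD2])
  then show ?thesis
    unfolding g_op_def using assms by simp
qed

text \<open>At the dispatch rate \<open>g_op\<close> the operation cost and the waiting cost
  balance, so the cost rate is twice the former, \<open>2 * k * g\<close>; its square is
  \<open>2 * k * c * f\<close>, where \<open>k * c\<close> is
  \<open>l\<^sub>0 * (c\<^sub>0 + \<alpha> * c)\<close>.\<close>

lemma cost_rate_eq:
  assumes f: "f t > 0" and c: "c t > 0"
  shows "seat_cost l\<^sub>0 c\<^sub>0 \<alpha> (c t) * g_op l\<^sub>0 c\<^sub>0 \<alpha> f c t + c t * f t / (2 * g_op l\<^sub>0 c\<^sub>0 \<alpha> f c t)
    = sqrt (2 * l\<^sub>0 * (c\<^sub>0 + \<alpha> * c t) * f t)"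
proof -
  define k where "k = seat_cost l\<^sub>0 c\<^sub>0 \<alpha> (c t)"
  define g where "g = g_op l\<^sub>0 c\<^sub>0 \<alpha> f c t"
  have k: "k > 0"
    unfolding k_def using c by (rule seat_cost_pos)
  have g: "g > 0" and g2: "g\<^sup>2 = c t * f t / (2 * k)"
    unfolding g_def g_op_def using f c k by (auto simp: k_def)
  have cf: "c t * f t = 2 * k * g\<^sup>2"
    using g2 k by simp
  then have "k * g + c t * f t / (2 * g) = 2 * k * g"
    using g by (simp add: power2_eq_square)
  moreover have "2 * l\<^sub>0 * (c\<^sub>0 + \<alpha> * c t) * f t = 2 * k * (c t * f t)"
    unfolding k_def seat_cost_def using c by simp
  then have "2 * l\<^sub>0 * (c\<^sub>0 + \<alpha> * c t) * f t = (2 * k * g)\<^sup>2"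
    unfolding cf by (simp add: power2_eq_square)
  ultimately show ?thesis
    using k g unfolding k_def g_def by simp
qed

end

text \<open>The window \<open>[a, a + T)\<close> is cut at its multiple \<open>b + k T\<close>; shifting the two pieces by
  \<open>(k - 1) T\<close> and \<open>k T\<close> reassembles them into \<open>[b, b + T)\<close>.\<close>

lemma nn_integral_window_le_period:
  fixes p G :: "real \<Rightarrow> ennreal"
  assumes T: "T > 0"
    and p: "(\<lambda>s. p s * indicator {b..<b + T} s) \<in> borel_measurable borel"
    and le: "\<And>s (j::int). s - j * T \<in> {b..<b + T} \<Longrightarrow> G s \<le> p (s - j * T)"
  shows "(\<integral>\<^sup>+s\<in>{a..a + T}. G s \<partial>lborel) \<le> (\<integral>\<^sup>+s\<in>{b..<b + T}. p s \<partial>lborel)"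
proof -
  \<comment> \<open>Among the translates of \<open>b\<close> by integer multiples of
    \<open>T\<close>, \<open>b + k * T\<close> is the first that is at least
    \<open>a\<close>.\<close>
  define k where "k = \<lceil>(a - b) / T\<rceil>"
  \<comment> \<open>Measurability of \<open>p\<close> is given on one period only, so
    \<open>p\<close> is cut off before it is shifted.\<close>
  define q where "q s = p s * indicator {b..<b + T} s" for s
  \<comment> \<open>The image of \<open>a\<close> in \<open>{b<..b + T}\<close>; it equals
    \<open>b + T\<close>, making the first piece empty, when \<open>a = b + k * T\<close>.\<close>
  define d where "d = a - (k - 1) * T"
  have [measurable]: "q \<in> borel_measurable borel"
    using p unfolding q_def .
  have "(a - b) / T \<le> k" "k - 1 < (a - b) / T"
    unfolding k_def by linarith+
  then have k: "a \<le> b + k * T" "b + (k - 1) * T < a"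
    using T by (simp_all add: field_simps)
  have "(\<integral>\<^sup>+s\<in>{a..a + T}. G s \<partial>lborel)
      \<le> (\<integral>\<^sup>+s. q (s - (k - 1) * T) * indicator {d..<b + T} (s - (k - 1) * T)
             + q (s - k * T) * indicator {b..<d} (s - k * T) \<partial>lborel)"
  proof (rule nn_integral_mono_AE)
    \<comment> \<open>The two pieces cover the half-open window; the right endpoint
      \<open>a + T\<close> is discarded as a null set.\<close>
    show "AE s in lborel. G s * indicator {a..a + T} s
        \<le> q (s - (k - 1) * T) * indicator {d..<b + T} (s - (k - 1) * T)
             + q (s - k * T) * indicator {b..<d} (s - k * T)"
      using AE_lborel_singleton[of "a + T"]
    proof eventually_elim
      case (elim s)
      consider "s \<notin> {a..a + T}" | "a \<le> s" "s < b + k * T" | "b + k * T \<le> s" "s < a + T"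
        using elim by fastforce
      then show ?case
      proof cases
        case 1
        then show ?thesis by simp
      next
        case 2
        then have "s - (k - 1) * T \<in> {b..<b + T}" "s - (k - 1) * T \<in> {d..<b + T}"
          using k by (auto simp: d_def algebra_simps)
        then have "G s \<le> q (s - (k - 1) * T) * indicator {d..<b + T} (s - (k - 1) * T)"
          using le[of s "k - 1"] by (simp add: q_def)
        then show ?thesis
          by (auto split: split_indicator intro: order_trans add_increasing2)
      next
        case 3
        then have "s - k * T \<in> {b..<b + T}" "s - k * T \<in> {b..<d}"
          using k by (auto simp: d_def algebra_simps)
        then have "G s \<le> q (s - k * T) * indicator {b..<d} (s - k * T)"
          using le[of s k] by (simp add: q_def)
        then show ?thesis
          by (auto split: split_indicator intro: order_trans add_increasing)
      qed
    qed
  qed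
  also have "\<dots> = (\<integral>\<^sup>+s. q (s - (k - 1) * T) * indicator {d..<b + T} (s - (k - 1) * T) \<partial>lborel)
      + (\<integral>\<^sup>+s. q (s - k * T) * indicator {b..<d} (s - k * T) \<partial>lborel)"
    by (rule nn_integral_add) measurable
  \<comment> \<open>Translation invariance of Lebesgue measure undoes both shifts.\<close>
  also have "\<dots> = (\<integral>\<^sup>+s. q s * indicator {d..<b + T} s \<partial>lborel)
      + (\<integral>\<^sup>+s. q s * indicator {b..<d} s \<partial>lborel)"
    using nn_integral_real_affine[of "\<lambda>s. q s * indicator {d..<b + T} s" 1 "- ((k - 1) * T)"]
      nn_integral_real_affine[of "\<lambda>s. q s * indicator {b..<d} s" 1 "- (k * T)"]
    by simp
  also have "\<dots> = (\<integral>\<^sup>+s. q s * indicator {d..<b + T} s + q s * indicator {b..<d} s \<partial>lborel)"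
    by (rule nn_integral_add[symmetric]) measurable
  also have "\<dots> = (\<integral>\<^sup>+s\<in>{b..<b + T}. p s \<partial>lborel)"
    using k by (intro nn_integral_cong) (auto simp: q_def d_def algebra_simps split: split_indicator)
  finally show ?thesis .
qed

text \<open>The recurrence is available on \<open>{b + T..d}\<close> only. Stepping back one period
  at a time, the argument stays in that interval until it reaches
  \<open>{b..<b + T}\<close>.\<close>

lemma periodic_on_shift:
  fixes g :: "real \<Rightarrow> 'a"
  assumes "T > 0" "\<And>t. t \<in> {b + T..d} \<Longrightarrow> g t = g (t - T)"
    and "s - real n * T \<in> {b..<b + T}" "s \<le> d"
  shows "g s = g (s - real n * T)"
  using assms(3,4)
proof (induction n arbitrary: s)
  case 0
  then show ?case by simp
next
  case (Suc n)
  have "real n * T \<ge> 0"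
    using \<open>T > 0\<close> by simp
  moreover have "b + T + real n * T \<le> s"
    using Suc.prems by (simp add: algebra_simps)
  ultimately have "s \<in> {b + T..d}"
    using Suc.prems(2) unfolding atLeastAtMost_iff by linarith
  then have "g s = g (s - T)"
    by (rule assms(2))
  also have "\<dots> = g (s - T - real n * T)"
    using Suc.prems \<open>T > 0\<close> by (intro Suc.IH) (auto simp: algebra_simps)
  finally show ?case
    by (simp add: algebra_simps)
qed

text \<open>The nonnegative difference \<open>v - u\<close> has integral 0, finiteness making the
  subtraction of integrals legitimate. Its vanishing yields \<open>v x \<le> u x\<close>, the
  converse of \<open>le\<close>.\<close>

lemma nn_integral_eq_imp_AE_eq:
  assumes [measurable]: "u \<in> borel_measurable M" "v \<in> borel_measurable M"
    and le: "AE x in M. u x \<le> v x"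
    and int: "integral\<^sup>N M v \<le> integral\<^sup>N M u" "integral\<^sup>N M u < \<infinity>"
  shows "AE x in M. u x = v x"
proof -
  have "(\<integral>\<^sup>+x. v x - u x \<partial>M) = integral\<^sup>N M v - integral\<^sup>N M u"
    using le int by (intro nn_integral_diff) auto
  also have "\<dots> = 0"
    using int by (simp add: diff_eq_0_iff_ennreal)
  finally have "AE x in M. v x - u x = 0"
    by (subst (asm) nn_integral_0_iff_AE) measurable
  then show ?thesis
    using le
  proof eventually_elim
    case (elim x)
    then show ?case
      by (auto simp: diff_eq_0_iff_ennreal)
  qed
qed

theorem mainTheorem5:
  fixes c\<^sub>0 \<gamma>\<^sub>0 l\<^sub>0 \<alpha> T t\<^sub>q t\<^sub>d M :: real
    and E Eop Epk :: "real set"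
    and f g_pk h :: "real \<Rightarrow> real"
  assumes "c\<^sub>0 > 0" "\<gamma>\<^sub>0 > 0" "l\<^sub>0 > 0" "\<alpha> > 0"
    and "T > 0" "t\<^sub>q \<le> t\<^sub>d"
    and "E \<in> sets lborel" "{t\<^sub>q - T..t\<^sub>d} \<subseteq> E"
    and Epk: "Epk = peak_period T t\<^sub>q t\<^sub>d"
    and Eop: "Eop = off_peak E T t\<^sub>q t\<^sub>d"
    and "set_borel_measurable lborel E f"
    and "\<forall>t\<in>E. f t > 0"
    and "\<forall>s\<in>Eop. \<forall>r\<in>Epk. f s \<le> f r"
    and "set_integrable lborel {t\<^sub>q - T..<t\<^sub>q} f"
    and "\<forall>s\<in>{t\<^sub>q - T..<t\<^sub>q}. g_pk s = f s"
    and M: "M = (LINT s:{t\<^sub>q - T..<t\<^sub>q}|lborel. g_pk s)"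
    and h: "peak_carryover T t\<^sub>q t\<^sub>d g_pk h"
  shows
    "(\<forall>c. (\<forall>t\<in>Eop. c t > 0) \<longrightarrow>
        J_op Eop l\<^sub>0 c\<^sub>0 \<alpha> f c = (\<integral>\<^sup>+t\<in>Eop. ennreal (sqrt (2 * l\<^sub>0 * (c\<^sub>0 + \<alpha> * c t) * f t)) \<partial>lborel))
     \<and> optimal_op Eop Epk T M h l\<^sub>0 c\<^sub>0 \<alpha> f (c_opt l\<^sub>0 c\<^sub>0 \<alpha> f)
     \<and> (\<forall>c. optimal_op Eop Epk T M h l\<^sub>0 c\<^sub>0 \<alpha> f c \<and> J_op Eop l\<^sub>0 c\<^sub>0 \<alpha> f c < \<infinity> \<longrightarrow>
          (AE t in lborel. t \<in> Eop \<longrightarrow> c t = c_opt l\<^sub>0 c\<^sub>0 \<alpha> f t))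
     \<and> (\<forall>t\<in>Eop. g_op l\<^sub>0 c\<^sub>0 \<alpha> f (c_opt l\<^sub>0 c\<^sub>0 \<alpha> f) t = f t)
     \<and> fleet_constraint Eop Epk T M h (g_op l\<^sub>0 c\<^sub>0 \<alpha> f (c_opt l\<^sub>0 c\<^sub>0 \<alpha> f))"
proof -
  note pos = \<open>c\<^sub>0 > 0\<close> \<open>l\<^sub>0 > 0\<close> \<open>\<alpha> > 0\<close>
  let ?c = "c_opt l\<^sub>0 c\<^sub>0 \<alpha> f"
  let ?F = "\<lambda>c t. sqrt (2 * l\<^sub>0 * (c\<^sub>0 + \<alpha> * c t) * f t)"
  have Eop_sub: "Eop \<subseteq> E"
    unfolding Eop off_peak_def by auto
  have [measurable]: "Eop \<in> sets borel"
    using \<open>E \<in> sets lborel\<close> unfolding Eop off_peak_def peak_period_def by simp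
  have fpos: "f t > 0" if "t \<in> Eop" for t
    using that Eop_sub \<open>\<forall>t\<in>E. f t > 0\<close> by auto
  have Epk_E: "Epk \<subseteq> E"
    unfolding Epk peak_period_def by fact
  have "set_borel_measurable lborel Eop f"
    using \<open>set_borel_measurable lborel E f\<close> _ Eop_sub by (rule set_borel_measurable_subset) simp
  then have f_meas [measurable]: "(\<lambda>t. indicator Eop t * f t) \<in> borel_measurable borel"
    unfolding set_borel_measurable_def by simp

  have J: "J_op Eop l\<^sub>0 c\<^sub>0 \<alpha> f c = (\<integral>\<^sup>+t\<in>Eop. ennreal (?F c t) \<partial>lborel)"
    if "\<forall>t\<in>Eop. c t > 0" for c
    unfolding J_op_def using that fpos
    by (intro nn_integral_cong) (auto simp: cost_rate_eq[OF pos] split: split_indicator)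

  have g: "\<forall>t\<in>Eop. g_op l\<^sub>0 c\<^sub>0 \<alpha> f ?c t = f t"
    using g_op_c_opt[OF pos] fpos by blast

  have fleet: "fleet_constraint Eop Epk T M h (g_op l\<^sub>0 c\<^sub>0 \<alpha> f ?c)"
    unfolding fleet_constraint_def
  proof
    fix t assume "t \<in> Eop"
    let ?G = "\<lambda>s. ennreal (if s \<in> Eop then g_op l\<^sub>0 c\<^sub>0 \<alpha> f ?c s else if s \<in> Epk then h s else 0)"
    have int: "integrable lborel (\<lambda>s. indicator {t\<^sub>q - T..<t\<^sub>q} s * f s)"
      using \<open>set_integrable lborel {t\<^sub>q - T..<t\<^sub>q} f\<close> unfolding set_integrable_def by simp
    have ind: "ennreal (f s) * indicator {t\<^sub>q - T..<t\<^sub>q} s = ennreal (indicator {t\<^sub>q - T..<t\<^sub>q} s * f s)"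
      for s by (simp split: split_indicator)
    have sub: "{t\<^sub>q - T..<t\<^sub>q} \<subseteq> Epk"
      unfolding Epk peak_period_def using \<open>t\<^sub>q \<le> t\<^sub>d\<close> by auto
    have "f s \<ge> 0" if "s \<in> {t\<^sub>q - T..<t\<^sub>q}" for s
      using that sub Epk_E \<open>\<forall>t\<in>E. f t > 0\<close> by (blast intro: less_imp_le)
    then have nonneg: "AE s in lborel. 0 \<le> indicator {t\<^sub>q - T..<t\<^sub>q} s * f s"
      by (auto split: split_indicator)
    \<comment> \<open>An off-peak rate at \<open>s\<close> is \<open>f s\<close>, which is at most
      the demand at any peak time, in particular at the shifted time. A peak rate is carried to the
      shifted time by periodicity.\<close>
    have bound: "?G s \<le> ennreal (f (s - j * T))" if s: "s - j * T \<in> {t\<^sub>q - T..<t\<^sub>q}" for s and j :: int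
    proof -
      have r: "s - j * T \<in> Epk"
        using s sub by blast
      have fr: "f (s - j * T) > 0"
        using r Epk_E \<open>\<forall>t\<in>E. f t > 0\<close> by blast
      have "h s \<le> f (s - j * T)" if "s \<in> Epk"
        using h unfolding peak_carryover_def
      proof (elim disjE conjE)
        assume "h = (\<lambda>_. 0)"
        then show ?thesis
          using fr by simp
      next
        assume "h = g_pk" and per: "\<forall>t\<in>{t\<^sub>q..t\<^sub>d}. g_pk t = g_pk (t - T)"
        have "t\<^sub>q - T \<le> s" "s \<le> t\<^sub>d"
          using that unfolding Epk peak_period_def by auto
        \<comment> \<open>A peak time is never before the base period, so it can only be shifted
          backwards; this is the direction in which the recurrence for \<open>g_pk\<close> is
          iterated.\<close>
        then have "0 < (j + 1) * T"
          using s by (simp add: algebra_simps)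
        then have "0 \<le> j"
          using \<open>T > 0\<close> by (simp add: zero_less_mult_iff)
        then obtain n where n: "j = int n"
          using nonneg_int_cases by blast
        have "g_pk s = g_pk (s - real n * T)"
          using \<open>T > 0\<close> per s \<open>s \<le> t\<^sub>d\<close>
          by (intro periodic_on_shift[where b = "t\<^sub>q - T" and d = t\<^sub>d]) (auto simp: n)
        with \<open>h = g_pk\<close> s \<open>\<forall>s\<in>{t\<^sub>q - T..<t\<^sub>q}. g_pk s = f s\<close> show ?thesis
          by (simp add: n)
      qed
      then show ?thesis
        using g r \<open>\<forall>s\<in>Eop. \<forall>r\<in>Epk. f s \<le> f r\<close> by (auto intro!: ennreal_leI)
    qed
    have "(\<integral>\<^sup>+s\<in>{t - T..t}. ?G s \<partial>lborel) = (\<integral>\<^sup>+s\<in>{t - T..(t - T) + T}. ?G s \<partial>lborel)"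
      by simp
    also have "\<dots> \<le> (\<integral>\<^sup>+s\<in>{t\<^sub>q - T..<(t\<^sub>q - T) + T}. ennreal (f s) \<partial>lborel)"
      using \<open>T > 0\<close> bound borel_measurable_integrable[OF int]
      by (intro nn_integral_window_le_period) (auto simp: ind)
    also have "\<dots> = (\<integral>\<^sup>+s. ennreal (indicator {t\<^sub>q - T..<t\<^sub>q} s * f s) \<partial>lborel)"
      by (simp add: ind)
    also have "\<dots> = ennreal (LINT s|lborel. indicator {t\<^sub>q - T..<t\<^sub>q} s * f s)"
      using int nonneg by (rule nn_integral_eq_integral)
    also have "(LINT s|lborel. indicator {t\<^sub>q - T..<t\<^sub>q} s * f s) = M"
      unfolding M set_lebesgue_integral_def using \<open>\<forall>s\<in>{t\<^sub>q - T..<t\<^sub>q}. g_pk s = f s\<close>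
      by (intro Bochner_Integration.integral_cong) (auto split: split_indicator)
    finally show "(\<integral>\<^sup>+s\<in>{t - T..t}. ?G s \<partial>lborel) \<le> ennreal M" .
  qed

  \<comment> \<open>\<open>c_opt\<close> vanishes where the demand is 0, so the cutoff to
    \<open>Eop\<close> can be moved onto \<open>f\<close>, whose restriction is measurable.\<close>
  have "(\<lambda>t. indicator Eop t * ?c t)
      = (\<lambda>t. c_opt l\<^sub>0 c\<^sub>0 \<alpha> (\<lambda>t. indicator Eop t * f t) t)"
    by (auto simp: c_opt_def split: split_indicator)
  also have "\<dots> \<in> borel_measurable borel"
    unfolding c_opt_def by measurable
  finally have feas: "feasible_op Eop Epk T M h l\<^sub>0 c\<^sub>0 \<alpha> f ?c"
    unfolding feasible_op_def set_borel_measurable_def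
    using c_opt_pos[OF pos] c_opt_eq_seat_cost[OF pos] fpos fleet by fastforce

  have le: "?c t \<le> c t" if "feasible_op Eop Epk T M h l\<^sub>0 c\<^sub>0 \<alpha> f c" "t \<in> Eop" for c t
    using that fpos unfolding feasible_op_def by (intro c_opt_le[OF pos]) auto
  have F_le: "?F ?c t \<le> ?F c t" if "feasible_op Eop Epk T M h l\<^sub>0 c\<^sub>0 \<alpha> f c" "t \<in> Eop" for c t
    using le[OF that] fpos[OF that(2)] pos by (simp add: mult_left_mono mult_right_mono)

  have opt: "optimal_op Eop Epk T M h l\<^sub>0 c\<^sub>0 \<alpha> f ?c"
    unfolding optimal_op_def
  proof (intro conjI allI impI feas)
    fix c assume c: "feasible_op Eop Epk T M h l\<^sub>0 c\<^sub>0 \<alpha> f c"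
    show "J_op Eop l\<^sub>0 c\<^sub>0 \<alpha> f ?c \<le> J_op Eop l\<^sub>0 c\<^sub>0 \<alpha> f c"
      using c feas F_le[OF c]
      by (subst (1 2) J)
        (auto simp: feasible_op_def split: split_indicator intro!: nn_integral_mono ennreal_leI)
  qed

  have F_meas: "(\<lambda>t. ennreal (?F c t) * indicator Eop t) \<in> borel_measurable lborel"
    if "feasible_op Eop Epk T M h l\<^sub>0 c\<^sub>0 \<alpha> f c" for c
  proof -
    have [measurable]: "(\<lambda>t. indicator Eop t * c t) \<in> borel_measurable borel"
      using that unfolding feasible_op_def set_borel_measurable_def by simp
    have "(\<lambda>t. ennreal (?F c t) * indicator Eop t) = (\<lambda>t. ennreal (sqrt (2 * l\<^sub>0 *
        (c\<^sub>0 + \<alpha> * (indicator Eop t * c t)) * (indicator Eop t * f t))) * indicator Eop t)"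
      by (auto split: split_indicator)
    also have "\<dots> \<in> borel_measurable lborel"
      by measurable
    finally show ?thesis .
  qed

  have unique: "AE t in lborel. t \<in> Eop \<longrightarrow> c t = ?c t"
    if c: "optimal_op Eop Epk T M h l\<^sub>0 c\<^sub>0 \<alpha> f c" and fin: "J_op Eop l\<^sub>0 c\<^sub>0 \<alpha> f c < \<infinity>" for c
  proof -
    have c_feas: "feasible_op Eop Epk T M h l\<^sub>0 c\<^sub>0 \<alpha> f c"
      using c unfolding optimal_op_def by blast
    have J_le: "J_op Eop l\<^sub>0 c\<^sub>0 \<alpha> f c \<le> J_op Eop l\<^sub>0 c\<^sub>0 \<alpha> f ?c"
      using c feas unfolding optimal_op_def by blast
    have J_ge: "J_op Eop l\<^sub>0 c\<^sub>0 \<alpha> f ?c \<le> J_op Eop l\<^sub>0 c\<^sub>0 \<alpha> f c"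
      using opt c_feas unfolding optimal_op_def by blast
    have cp: "\<forall>t\<in>Eop. c t > 0" "\<forall>t\<in>Eop. ?c t > 0"
      using c_feas feas unfolding feasible_op_def by blast+
    \<comment> \<open>Both sizes are optimal, so their cost integrals agree and are finite, while
      the integrands are ordered pointwise.\<close>
    have "AE t in lborel. ennreal (?F ?c t) * indicator Eop t = ennreal (?F c t) * indicator Eop t"
      using J_le order_le_less_trans[OF J_ge fin] F_le[OF c_feas] unfolding cp[THEN J]
      by (intro nn_integral_eq_imp_AE_eq F_meas c_feas feas)
        (auto split: split_indicator intro!: AE_I2 ennreal_leI)
    then show ?thesis
    proof eventually_elim
      case (elim t)
      show ?case
      proof
        assume t: "t \<in> Eop"
        have "?F ?c t \<ge> 0" "?F c t \<ge> 0"
          using fpos[OF t] cp t pos by (simp_all add: less_imp_le)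
        then have "?F ?c t = ?F c t"
          using elim t by simp
        \<comment> \<open>The square root is injective, and the coefficient
          \<open>2 * l\<^sub>0 * \<alpha> * f t\<close> of \<open>c t\<close> under it is
          nonzero.\<close>
        then show "c t = ?c t"
          using fpos[OF t] pos by simp
      qed
    qed
  qed

  show ?thesis
    using J opt unique g fleet by blast
qed

end
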